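(* Let $\mathcal{H}$ be a real Hilbert space, $P,S\in\mathcal{P}(\mathcal{H})$ and $\beta\in[0,4)$. Assume that $A:\mathcal{H}\to 2^{\mathcal{H}}$ is maximally monotone, that $C:\mathcal{H}\to\mathcal{H}$ is $\frac1\beta$-cocoercive w.r.t. $\|\cdot\|_P$, that $\mathrm{zer}(A+C):=\{x\in\mathcal{H}:0\in Ax+Cx\}\neq\emptyset$, and that for every $k\in\mathbb{N}$ the operator $M_k:\mathcal{H}\to\mathcal{H}$ is (single-valued and) maximally monotone, $1$-strongly monotone w.r.t. $\|\cdot\|_P$, and $L_M$-Lipschitz continuous w.r.t. $\|\cdot\|$ (with $L_M$ independent of $k$). Let $\theta_k\in(0,2)$ satisfy $\liminf_{k\to\infty}\theta_k(2-\theta_k)>0$. Let $x_0\in\mathcal{H}$ and, for $k=0,1,\ldots$, let $$\hat x_k:=(M_k+A)^{-1}(M_k-C)x_k,$$ $$H_k:=\{z\in\mathcal{H}:\langle M_kx_k-M_k\hat x_k,z-\hat x_k\rangle\le\tfrac{\beta}{4}\|x_k-\hat x_k\|_P^2\},$$ $$x_{k+1}:=(1-\theta_k)x_k+\theta_k\Pi^S_{H_k}(x_k).$$ Then sequences $(x_k)_{k\in\mathbb{N}}$ and $(\hat x_k)_{k\in\mathbb{N}}$ are constructed such that (i) $(\|x_k-z\|_S)_{k\in\mathbb{N}}$ converges for every $z\in\mathrm{zer}(A+C)$; (ii) $(\|x_k-\hat x_k\|_S)_{k\in\mathbb{N}}$ converges to $0$; (iii) $(x_k)_{k\in\mathbb{N}}$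 converges weakly to a point in $\mathrm{zer}(A+C)$.
   Context: $\mathcal{P}(\mathcal{H})$ is the set of bounded linear self-adjoint positive definite operators on $\mathcal{H}$ (positive definite in the sense that there are $0<\lambda_{\min}(P)\le\lambda_{\max}(P)<\infty$ with $\lambda_{\min}(P)\|x\|^2\le\langle x,Px\rangle\le\lambda_{\max}(P)\|x\|^2$ for all $x$); $\|x\|_P=\sqrt{\langle x,Px\rangle}$. $C$ is $\frac1\beta$-cocoercive w.r.t. $\|\cdot\|_P$ if $\langle Cx-Cy,x-y\rangle\ge\frac1\beta\|Cx-Cy\|_{P^{-1}}^2$ for all $x,y$; for $\beta=0$ this means that $C$ is constant. $M_k$ is $1$-strongly monotone w.r.t. $\|\cdot\|_P$ if $\langle M_kx-M_ky,x-y\rangle\ge\|x-y\|_P^2$ for all $x,y$. $\Pi_H^S(x)=\mathrm{argmin}_{y\in H}\|x-y\|_S$ is the projection onto a nonempty closed convex set $H$ in the norm $\|\cdot\|_S$. The iterative scheme is called nonlinear forward-backward splitting (NOFOB). *)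

theory Defs
  imports "HOL-Analysis.Analysis"
begin

text \<open>
  Real Hilbert spaces are types of sort \<open>{real_inner, complete_space}\<close>. A set-valued operator is a
  function \<open>'a \<Rightarrow> 'a set\<close>; a single-valued \<open>M\<close> is regarded as the set-valued operator \<open>\<lambda>x. {M x}\<close>.
\<close>

definition posdef_ops :: "('a::real_inner \<Rightarrow> 'a) set" where
  "posdef_ops = {P. bounded_linear P \<and> (\<forall>x y. P x \<bullet> y = x \<bullet> P y) \<and>
     (\<exists>l u. 0 < l \<and> l \<le> u \<and> (\<forall>x. l * (norm x)\<^sup>2 \<le> x \<bullet> P x \<and> x \<bullet> P x \<le> u * (norm x)\<^sup>2))}"

definition wnorm :: "('a::real_inner \<Rightarrow> 'a) \<Rightarrow> 'a \<Rightarrow> real" where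
  "wnorm P x = sqrt (x \<bullet> P x)"

definition monotone_op :: "('a::real_inner \<Rightarrow> 'a set) \<Rightarrow> bool" where
  "monotone_op A \<longleftrightarrow> (\<forall>x y. \<forall>u\<in>A x. \<forall>v\<in>A y. 0 \<le> (u - v) \<bullet> (x - y))"

definition maximal_monotone :: "('a::real_inner \<Rightarrow> 'a set) \<Rightarrow> bool" where
  "maximal_monotone A \<longleftrightarrow>
     monotone_op A \<and> (\<forall>B. monotone_op B \<and> (\<forall>x. A x \<subseteq> B x) \<longrightarrow> B = A)"

definition op_sum :: "('a::real_inner \<Rightarrow> 'a set) \<Rightarrow> ('a \<Rightarrow> 'a set) \<Rightarrow> 'a \<Rightarrow> 'a set" where
  "op_sum A B x = {u + v |u v. u \<in> A x \<and> v \<in> B x}"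

definition op_inverse :: "('a \<Rightarrow> 'a set) \<Rightarrow> 'a \<Rightarrow> 'a set" where
  "op_inverse A u = {x. u \<in> A x}"

definition zer :: "('a::real_inner \<Rightarrow> 'a set) \<Rightarrow> 'a set" where
  "zer A = {x. 0 \<in> A x}"

text \<open>
  \<open>cocoercive_wrt P \<beta> C\<close> is \<open>1/\<beta>\<close>-cocoercivity. The case \<open>\<beta> = 0\<close> is separate, because
  \<open>1 / 0 = 0\<close> in HOL would turn the inequality into plain monotonicity. For \<open>P \<in> posdef_ops\<close> on a
  complete space \<open>P\<close> is bijective, so \<open>inv P\<close> is the genuine inverse.
\<close>

definition cocoercive_wrt :: "('a::real_inner \<Rightarrow> 'a) \<Rightarrow> real \<Rightarrow> ('a \<Rightarrow> 'a) \<Rightarrow> bool" where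
  "cocoercive_wrt P \<beta> C \<longleftrightarrow>
     (if \<beta> = 0 then \<forall>x y. C x = C y
      else \<forall>x y. (C x - C y) \<bullet> (x - y) \<ge> 1 / \<beta> * (wnorm (inv P) (C x - C y))\<^sup>2)"

definition strongly_monotone_wrt :: "('a::real_inner \<Rightarrow> 'a) \<Rightarrow> real \<Rightarrow> ('a \<Rightarrow> 'a) \<Rightarrow> bool" where
  "strongly_monotone_wrt P \<sigma> M \<longleftrightarrow>
     (\<forall>x y. (M x - M y) \<bullet> (x - y) \<ge> \<sigma> * (wnorm P (x - y))\<^sup>2)"

text \<open>The set of minimisers; that it is a singleton is not built in.\<close>

definition proj_set :: "('a::real_inner \<Rightarrow> 'a) \<Rightarrow> 'a set \<Rightarrow> 'a \<Rightarrow> 'a set" where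
  "proj_set S H x = {p. is_arg_min (\<lambda>y. wnorm S (x - y)) (\<lambda>y. y \<in> H) p}"

definition nofob_halfspace ::
  "('a::real_inner \<Rightarrow> 'a) \<Rightarrow> real \<Rightarrow> ('a \<Rightarrow> 'a) \<Rightarrow> 'a \<Rightarrow> 'a \<Rightarrow> 'a set" where
  "nofob_halfspace P \<beta> M x xh =
     {z. (M x - M xh) \<bullet> (z - xh) \<le> \<beta> / 4 * (wnorm P (x - xh))\<^sup>2}"

text \<open>
  The resolvent step and the projection are set-valued relations here, so that their
  well-definedness is a claim about this predicate (existence and uniqueness of the sequences)
  rather than a consequence of a choice operator.
\<close>

definition nofob_iterates ::
  "('a::real_inner \<Rightarrow> 'a) \<Rightarrow> ('a \<Rightarrow> 'a) \<Rightarrow> real \<Rightarrow> ('a \<Rightarrow> 'a set) \<Rightarrow> ('a \<Rightarrow> 'a) \<Rightarrow>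
   (nat \<Rightarrow> 'a \<Rightarrow> 'a) \<Rightarrow> (nat \<Rightarrow> real) \<Rightarrow> 'a \<Rightarrow> (nat \<Rightarrow> 'a) \<Rightarrow> (nat \<Rightarrow> 'a) \<Rightarrow> bool" where
  "nofob_iterates P S \<beta> A C M \<theta> x0 x xh \<longleftrightarrow>
     x 0 = x0 \<and>
     (\<forall>k. xh k \<in> op_inverse (op_sum (\<lambda>y. {M k y}) A) (M k (x k) - C (x k)) \<and>
          (\<exists>p \<in> proj_set S (nofob_halfspace P \<beta> (M k) (x k) (xh k)) (x k).
             x (Suc k) = (1 - \<theta> k) *\<^sub>R x k + \<theta> k *\<^sub>R p))"

definition weakly_converges :: "(nat \<Rightarrow> 'a::real_inner) \<Rightarrow> 'a \<Rightarrow> bool" where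
  "weakly_converges x l \<longleftrightarrow> (\<forall>y. (\<lambda>k. x k \<bullet> y) \<longlonglongrightarrow> l \<bullet> y)"

end

theory Submission
  imports Defs
begin

text \<open>
  A solution \<open>z\<close> satisfies \<open>- C z \<in> A z\<close>; monotonicity of \<open>A\<close> at the resolvent point together with
  Young's inequality for the cocoercive \<open>C\<close> puts every solution into the halfspace \<open>H\<^sub>k\<close>. Hence the
  relaxed projections are Fejer monotone in the \<open>S\<close>-norm and the projection steps vanish. Strong
  monotonicity and the Lipschitz bound on \<open>M\<^sub>k\<close> bound the distance from \<open>x\<^sub>k\<close> to the resolvent
  point by the projection step, and this is where \<open>\<beta> < 4\<close> enters. Weak cluster points are then solutions, and by Opial's
  argument there is only one.

  Solvability of \<open>y \<in> M x + A x\<close> comes from Minty's theorem and a contraction argument. Both Minty's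
  theorem (through the Fitzpatrick function) and the Riesz representation reduce to minimising
  \<open>t + (norm z)\<^sup>2 / 2\<close> over a closed convex set of pairs \<open>(z, t)\<close>.
\<close>

section \<open>Quadratic minimisation\<close>

text \<open>The conclusion is the first-order optimality condition for minimising
  \<open>t + (norm z)\<^sup>2 / 2\<close> over \<open>E\<close>. The lower bound keeps this
  functional bounded below, and its strong convexity in \<open>z\<close> makes minimising sequences
  Cauchy, so a minimiser exists without any appeal to weak compactness.\<close>

lemma quadratic_minimizer:
  fixes E :: "('a::{real_inner,complete_space} \<times> real) set"
  assumes cl: "closed E" and cv: "convex E" and ne: "E \<noteq> {}"
    and lower: "\<And>z t. (z, t) \<in> E \<Longrightarrow> - (K * norm z) - c \<le> t"
  shows "\<exists>z0 t0. (z0, t0) \<in> E \<and> (\<forall>z t. (z, t) \<in> E \<longrightarrow> t0 - z0 \<bullet> (z - z0) \<le> t)"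
proof -
  define g :: "'a \<times> real \<Rightarrow> real" where "g p = snd p + (norm (fst p))\<^sup>2 / 2" for p
  \<comment> \<open>Completing the square in \<open>norm (fst p)\<close> absorbs the linear term
    \<open>- (K * norm z)\<close>.\<close>
  have glow: "- K\<^sup>2 / 2 - c \<le> g p" if "p \<in> E" for p
    using lower[of "fst p" "snd p"] that zero_le_power2[of "norm (fst p) - K"]
    by (simp add: g_def power2_eq_square algebra_simps)
  define m where "m = Inf (g ` E)"
  have bdd: "bdd_below (g ` E)" using glow by (auto intro!: bdd_belowI)
  have m_le: "m \<le> g p" if "p \<in> E" for p
    unfolding m_def using bdd that by (auto intro: cInf_lower)
  have ex: "\<exists>p\<in>E. g p < m + 1 / real (Suc n)" for n
  proof -
    have "Inf (g ` E) < m + 1 / real (Suc n)" unfolding m_def by simp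
    then show ?thesis using cInf_less_iff[OF _ bdd] ne by auto
  qed
  then obtain s where sE: "\<And>n. s n \<in> E" and sm: "\<And>n. g (s n) < m + 1 / real (Suc n)"
    by metis
  \<comment> \<open>By the parallelogram identity, \<open>g\<close> at the midpoint equals the
    average of \<open>g p\<close> and \<open>g q\<close> minus
    \<open>(norm (fst p - fst q))\<^sup>2 / 8\<close>, and it is at least \<open>m\<close>.\<close>
  have mid: "(norm (fst p - fst q))\<^sup>2 \<le> 4 * (g p + g q - 2 * m)" if "p \<in> E" "q \<in> E" for p q
  proof -
    have "(1/2) *\<^sub>R p + (1/2) *\<^sub>R q \<in> E"
      using cv that by (intro convexD) auto
    from m_le[OF this] show ?thesis
      by (simp add: g_def power2_norm_eq_inner inner_simps inner_commute field_simps)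
  qed
  have g_lim: "(\<lambda>n. g (s n)) \<longlonglongrightarrow> m"
  proof (rule tendsto_sandwich[of "\<lambda>_. m" _ _ "\<lambda>n. m + 1 / real (Suc n)"])
    show "(\<lambda>n. m + 1 / real (Suc n)) \<longlonglongrightarrow> m"
      using tendsto_add[OF tendsto_const LIMSEQ_inverse_real_of_nat, of m]
      by (simp add: inverse_eq_divide)
  qed (use m_le sE less_imp_le[OF sm] in \<open>auto simp only: eventually_sequentially\<close>)
  have "Cauchy (\<lambda>n. fst (s n))"
  proof (rule metric_CauchyI)
    fix e :: real assume "0 < e"
    then have "\<forall>\<^sub>F n in sequentially. g (s n) < m + e\<^sup>2 / 8"
      using g_lim by (intro order_tendstoD) auto
    then obtain N where N: "\<And>n. n \<ge> N \<Longrightarrow> g (s n) < m + e\<^sup>2 / 8"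
      by (auto simp: eventually_sequentially)
    show "\<exists>N. \<forall>i\<ge>N. \<forall>j\<ge>N. dist (fst (s i)) (fst (s j)) < e"
    proof (intro exI allI impI)
      fix i j assume "N \<le> i" "N \<le> j"
      then have "g (s i) < m + e\<^sup>2 / 8" "g (s j) < m + e\<^sup>2 / 8" by (simp_all add: N)
      then have "(norm (fst (s i) - fst (s j)))\<^sup>2 < e\<^sup>2"
        using mid[OF sE sE, of i j] by (simp add: field_simps)
      then show "dist (fst (s i)) (fst (s j)) < e"
        using \<open>0 < e\<close> by (simp add: dist_norm power2_less_imp_less)
    qed
  qed
  then obtain z0 where z0: "(\<lambda>n. fst (s n)) \<longlonglongrightarrow> z0"
    using Cauchy_convergent convergent_def by blast
  \<comment> \<open>This makes \<open>g (z0, t0) = m\<close>. The second components converge to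
    \<open>t0\<close> because both \<open>g (s n)\<close> and the norms of the first components
    converge.\<close>
  define t0 where "t0 = m - (norm z0)\<^sup>2 / 2"
  have "(\<lambda>n. g (s n) - (norm (fst (s n)))\<^sup>2 / 2) \<longlonglongrightarrow> t0"
    unfolding t0_def by (intro tendsto_intros g_lim z0) auto
  then have "(\<lambda>n. snd (s n)) \<longlonglongrightarrow> t0" by (simp add: g_def)
  then have "s \<longlonglongrightarrow> (z0, t0)" using tendsto_Pair[OF z0, of "\<lambda>n. snd (s n)" t0] by simp
  then have inE: "(z0, t0) \<in> E"
    by (rule closed_sequentially[OF cl sE])
  have "t0 - z0 \<bullet> (z - z0) \<le> t" if "(z, t) \<in> E" for z t
  proof -
    \<comment> \<open>The value \<open>m\<close> is compared with \<open>g\<close> at the fraction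
      \<open>r\<close> of the segment from \<open>(z0, t0)\<close> to \<open>(z, t)\<close>, and the
      difference is divided by \<open>r\<close>. Letting \<open>r\<close> tend to 0 removes the
      quadratic remainder.\<close>
    have key: "0 \<le> (t - t0 + z0 \<bullet> (z - z0)) + r * ((norm (z - z0))\<^sup>2 / 2)" if r: "0 < r" "r < 1" for r
    proof -
      have "(1 - r) *\<^sub>R (z0, t0) + r *\<^sub>R (z, t) \<in> E"
        using cv inE \<open>(z, t) \<in> E\<close> r by (intro convexD) auto
      moreover have "(1 - r) *\<^sub>R (z0, t0) + r *\<^sub>R (z, t) = (z0 + r *\<^sub>R (z - z0), t0 + r * (t - t0))"
        by (simp add: algebra_simps)
      ultimately have "m \<le> g (z0 + r *\<^sub>R (z - z0), t0 + r * (t - t0))" using m_le by metis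
      also have "\<dots> = m + r * ((t - t0 + z0 \<bullet> (z - z0)) + r * ((norm (z - z0))\<^sup>2 / 2))"
        unfolding g_def t0_def fst_conv snd_conv power2_norm_eq_inner inner_add_left inner_add_right
          inner_scaleR_left inner_scaleR_right
        by (simp add: algebra_simps inner_commute add_divide_distrib diff_divide_distrib)
      finally show ?thesis using r by (simp add: zero_le_mult_iff)
    qed
    have "((\<lambda>r. (t - t0 + z0 \<bullet> (z - z0)) + r * ((norm (z - z0))\<^sup>2 / 2)) \<longlongrightarrow>
        (t - t0 + z0 \<bullet> (z - z0)) + 0 * ((norm (z - z0))\<^sup>2 / 2)) (at_right 0)"
      by (intro tendsto_intros)
    moreover have "\<forall>\<^sub>F r in at_right 0. 0 \<le> (t - t0 + z0 \<bullet> (z - z0)) + r * ((norm (z - z0))\<^sup>2 / 2)"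
      using eventually_at_right_real[OF zero_less_one] by (rule eventually_mono) (simp only: key greaterThanLessThan_iff)
    ultimately have "0 \<le> (t - t0 + z0 \<bullet> (z - z0)) + 0 * ((norm (z - z0))\<^sup>2 / 2)"
      by (intro tendsto_lowerbound) auto
    then show ?thesis by simp
  qed
  with inE show ?thesis by blast
qed

text \<open>The set \<open>E\<close> is the epigraph of \<open>- \<phi>\<close>. Optimality at the
  minimiser \<open>l\<close> gives \<open>\<phi> y \<le> l \<bullet> y\<close> for every
  \<open>y\<close>; replacing \<open>y\<close> by \<open>- y\<close> gives the reverse
  inequality.\<close>

lemma riesz_representation:
  fixes \<phi> :: "'a::{real_inner,complete_space} \<Rightarrow> real"
  assumes "bounded_linear \<phi>"
  obtains l where "\<And>y. \<phi> y = l \<bullet> y"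
proof -
  interpret bounded_linear \<phi> by fact
  obtain K where K: "\<And>y. \<bar>\<phi> y\<bar> \<le> norm y * K" using bounded by auto
  define E :: "('a \<times> real) set" where "E = {p. - \<phi> (fst p) \<le> snd p}"
  have "closed E"
    unfolding E_def by (intro closed_Collect_le continuous_intros continuous_on)
  moreover have "convex E"
    unfolding convex_alt
  proof (intro ballI allI impI)
    fix p q :: "'a \<times> real" and u :: real
    assume pq: "p \<in> E" "q \<in> E" and u: "0 \<le> u \<and> u \<le> 1"
    have "(1 - u) * (- \<phi> (fst p)) + u * (- \<phi> (fst q)) \<le> (1 - u) * snd p + u * snd q"
      using pq u by (intro add_mono mult_left_mono) (auto simp: E_def)
    then show "(1 - u) *\<^sub>R p + u *\<^sub>R q \<in> E"
      by (simp add: E_def add scaleR)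
  qed
  moreover have "(0, - \<phi> 0) \<in> E" by (simp add: E_def)
  then have "E \<noteq> {}" by blast
  moreover have "- (K * norm z) - 0 \<le> t" if "(z, t) \<in> E" for z t
    using that K[of z] by (simp add: E_def mult.commute abs_le_iff)
  ultimately obtain l t where min: "(l, t) \<in> E" "\<And>z s. (z, s) \<in> E \<Longrightarrow> t - l \<bullet> (z - l) \<le> s"
    using quadratic_minimizer[of E K 0] by blast
  have le: "\<phi> y \<le> l \<bullet> y" for y
    using min(2)[of "l + y" "- \<phi> (l + y)"] min(1) by (simp add: E_def add)
  have "\<phi> y = l \<bullet> y" for y
    using le[of y] le[of "- y"] by (simp add: neg)
  then show ?thesis by (rule that)
qed

section \<open>Minty's theorem\<close>

text \<open>A pair monotonically related to the whole graph can be added to it without losing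
  monotonicity, so maximality already contains it. Conversely, every pair of a monotone extension is
  related to the graph of \<open>A\<close>.\<close>

lemma maximal_monotone_iff:
  "maximal_monotone A \<longleftrightarrow> monotone_op A \<and>
     (\<forall>x y. (\<forall>a. \<forall>u\<in>A a. 0 \<le> (y - u) \<bullet> (x - a)) \<longrightarrow> y \<in> A x)"
proof (intro iffI conjI allI impI)
  assume "maximal_monotone A"
  then have mono: "monotone_op A"
    and max: "\<And>B. monotone_op B \<Longrightarrow> (\<And>x. A x \<subseteq> B x) \<Longrightarrow> B = A"
    by (auto simp: maximal_monotone_def)
  show "monotone_op A" by (fact mono)
  fix x y assume *: "\<forall>a. \<forall>u\<in>A a. 0 \<le> (y - u) \<bullet> (x - a)"
  have **: "0 \<le> (u - y) \<bullet> (a - x)" if "u \<in> A a" for a u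
    using * that by (metis inner_minus_left inner_minus_right minus_diff_eq minus_minus)
  have "monotone_op (A(x := insert y (A x)))"
    using mono * ** unfolding monotone_op_def by (auto simp: fun_upd_def)
  then have "A(x := insert y (A x)) = A" by (rule max) auto
  then show "y \<in> A x" by (metis fun_upd_same insertI1)
next
  assume *: "monotone_op A \<and> (\<forall>x y. (\<forall>a. \<forall>u\<in>A a. 0 \<le> (y - u) \<bullet> (x - a)) \<longrightarrow> y \<in> A x)"
  have "B x \<subseteq> A x" if B: "monotone_op B" "\<forall>x. A x \<subseteq> B x" for B x
    using * B unfolding monotone_op_def by (meson subset_iff)
  then show "maximal_monotone A"
    using * unfolding maximal_monotone_def by blast
qed

lemma maximal_monotoneD:
  "maximal_monotone A \<Longrightarrow> u \<in> A x \<Longrightarrow> v \<in> A y \<Longrightarrow> 0 \<le> (u - v) \<bullet> (x - y)"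
  unfolding maximal_monotone_def monotone_op_def by blast

text \<open>The minimised epigraph is that of the Fitzpatrick function of \<open>A\<close> on the product space.\<close>

lemma maximal_monotone_uminus_ex:
  fixes A :: "'a::{real_inner,complete_space} \<Rightarrow> 'a set"
  assumes "maximal_monotone A"
  shows "\<exists>x. - x \<in> A x"
proof -
  from assms have mono: "\<And>x y u v. u \<in> A x \<Longrightarrow> v \<in> A y \<Longrightarrow> 0 \<le> (u - v) \<bullet> (x - y)"
    and max: "\<And>x y. (\<And>a u. u \<in> A a \<Longrightarrow> 0 \<le> (y - u) \<bullet> (x - a)) \<Longrightarrow> y \<in> A x"
    unfolding maximal_monotone_iff monotone_op_def by blast+
  \<comment> \<open>Over an empty graph the premise of \<open>max\<close> is vacuous, so
    \<open>max\<close> itself would supply a point of the graph.\<close>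
  obtain a0 u0 where a0: "u0 \<in> A a0" using max by blast
  define E :: "(('a \<times> 'a) \<times> real) set" where
    "E = {p. \<forall>a. \<forall>u\<in>A a. (u, a) \<bullet> fst p - a \<bullet> u \<le> snd p}"
  have graph: "((a, u), a \<bullet> u) \<in> E" if "u \<in> A a" for a u
  proof -
    have "(v, b) \<bullet> (a, u) - b \<bullet> v \<le> a \<bullet> u" if "v \<in> A b" for b v
      using mono[OF \<open>u \<in> A a\<close> that] by (simp add: inner_diff inner_commute algebra_simps)
    then show ?thesis by (simp add: E_def)
  qed
  have "E = (\<Inter>a. \<Inter>u\<in>A a. {p. (u, a) \<bullet> fst p - a \<bullet> u \<le> snd p})" by (auto simp: E_def)
  then have "closed E"
    by (simp only:) (intro closed_INT ballI closed_Collect_le continuous_intros)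
  moreover have "convex E"
    unfolding convex_alt
  proof (intro ballI allI impI)
    fix p q :: "('a \<times> 'a) \<times> real" and r :: real
    assume pq: "p \<in> E" "q \<in> E" and r: "0 \<le> r \<and> r \<le> 1"
    show "(1 - r) *\<^sub>R p + r *\<^sub>R q \<in> E"
      unfolding E_def
    proof (intro CollectI allI ballI)
      fix a u assume "u \<in> A a"
      then have "(1 - r) * ((u, a) \<bullet> fst p - a \<bullet> u) + r * ((u, a) \<bullet> fst q - a \<bullet> u)
          \<le> (1 - r) * snd p + r * snd q"
        using pq r by (intro add_mono mult_left_mono) (auto simp: E_def)
      then show "(u, a) \<bullet> fst ((1 - r) *\<^sub>R p + r *\<^sub>R q) - a \<bullet> u \<le> snd ((1 - r) *\<^sub>R p + r *\<^sub>R q)"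
        unfolding fst_add fst_scaleR snd_add snd_scaleR inner_add_right inner_scaleR_right
        by (simp add: algebra_simps)
    qed
  qed
  moreover have "E \<noteq> {}" using graph[OF a0] by blast
  moreover have "- (norm (u0, a0) * norm z) - a0 \<bullet> u0 \<le> t" if "(z, t) \<in> E" for z t
  proof -
    have "(u0, a0) \<bullet> z - a0 \<bullet> u0 \<le> t" using that a0 by (simp add: E_def)
    moreover have "- (norm (u0, a0) * norm z) \<le> (u0, a0) \<bullet> z"
      using Cauchy_Schwarz_ineq2[of "(u0, a0)" z] by linarith
    ultimately show ?thesis by linarith
  qed
  ultimately obtain z0 t0 where min: "(z0, t0) \<in> E"
      "\<And>z t. (z, t) \<in> E \<Longrightarrow> t0 - z0 \<bullet> (z - z0) \<le> t"
    using quadratic_minimizer[of E "norm (u0, a0)" "a0 \<bullet> u0"] by blast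
  obtain x y where z0: "z0 = (x, y)" by fastforce
  \<comment> \<open>The Fitzpatrick function dominates the duality pairing. Otherwise
    \<open>(x, y)\<close> would be strictly related to every point of the graph, hence lie in the
    graph by maximality, hence be strictly related to itself.\<close>
  have fitz: "x \<bullet> y \<le> t0"
  proof (rule ccontr)
    assume "\<not> x \<bullet> y \<le> t0"
    have pos: "0 < (y - u) \<bullet> (x - a)" if "u \<in> A a" for a u
    proof -
      have "(u, a) \<bullet> (x, y) - a \<bullet> u \<le> t0" using min(1) that by (simp add: E_def z0)
      then show ?thesis
        using \<open>\<not> x \<bullet> y \<le> t0\<close> by (simp add: inner_diff inner_commute algebra_simps)
    qed
    then have "y \<in> A x" by (intro max) (simp add: less_imp_le)
    then show False using pos by fastforce
  qed
  \<comment> \<open>The optimality condition is tested at the graph points of \<open>E\<close>, and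
    the square is completed with \<open>fitz\<close>. Hence \<open>(- y, - x)\<close> is related to
    the graph and belongs to it; taking this very point for \<open>(a, u)\<close> then forces
    \<open>x + y = 0\<close>.\<close>
  have rel: "(norm (x + y))\<^sup>2 \<le> (- x - u) \<bullet> (- y - a)" if "u \<in> A a" for a u
    using min(2)[OF graph[OF that]] fitz unfolding z0 power2_norm_eq_inner
    by (simp add: inner_simps inner_commute algebra_simps)
  have "- x \<in> A (- y)"
    by (rule max) (meson order_trans rel zero_le_power2)
  then have "- x \<in> A (- y)" "x + y = 0" using rel by fastforce+
  then show ?thesis by (metis add_eq_0_iff minus_minus)
qed

text \<open>Scaling the values of \<open>A\<close> by a positive factor and translating them
  preserves maximal monotonicity. For the resulting \<open>B\<close>, a point with
  \<open>- x \<in> B x\<close> is a solution.\<close>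

theorem minty:
  fixes A :: "'a::{real_inner,complete_space} \<Rightarrow> 'a set"
  assumes A: "maximal_monotone A" and "0 < \<gamma>"
  shows "\<exists>x. \<exists>u\<in>A x. x + \<gamma> *\<^sub>R u = y"
proof -
  define B where "B x = (\<lambda>u. \<gamma> *\<^sub>R u - y) ` A x" for x
  from A have mono: "\<And>x y u v. u \<in> A x \<Longrightarrow> v \<in> A y \<Longrightarrow> 0 \<le> (u - v) \<bullet> (x - y)"
    and max: "\<And>x y. (\<And>a u. u \<in> A a \<Longrightarrow> 0 \<le> (y - u) \<bullet> (x - a)) \<Longrightarrow> y \<in> A x"
    unfolding maximal_monotone_iff monotone_op_def by blast+
  have "maximal_monotone B"
    unfolding maximal_monotone_iff monotone_op_def
  proof (intro conjI allI ballI impI)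
    fix x x' v v' assume "v \<in> B x" "v' \<in> B x'"
    then obtain u u' where u: "u \<in> A x" "v = \<gamma> *\<^sub>R u - y" "u' \<in> A x'" "v' = \<gamma> *\<^sub>R u' - y"
      by (auto simp: B_def)
    then have "v - v' = \<gamma> *\<^sub>R (u - u')" by (simp add: scaleR_diff_right)
    then show "0 \<le> (v - v') \<bullet> (x - x')" using mono[OF u(1) u(3)] \<open>0 < \<gamma>\<close> by simp
  next
    fix x v assume *: "\<forall>a. \<forall>w\<in>B a. 0 \<le> (v - w) \<bullet> (x - a)"
    have "(v + y) /\<^sub>R \<gamma> \<in> A x"
    proof (rule max)
      fix a u assume "u \<in> A a"
      then have "0 \<le> (v - (\<gamma> *\<^sub>R u - y)) \<bullet> (x - a)" using * by (auto simp: B_def)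
      moreover have "v - (\<gamma> *\<^sub>R u - y) = \<gamma> *\<^sub>R ((v + y) /\<^sub>R \<gamma> - u)"
        using \<open>0 < \<gamma>\<close> by (simp add: algebra_simps)
      ultimately show "0 \<le> ((v + y) /\<^sub>R \<gamma> - u) \<bullet> (x - a)"
        using \<open>0 < \<gamma>\<close> by (simp add: zero_le_mult_iff)
    qed
    then show "v \<in> B x" unfolding B_def using \<open>0 < \<gamma>\<close> by (force simp: image_iff)
  qed
  from maximal_monotone_uminus_ex[OF this] obtain x u where "u \<in> A x" "- x = \<gamma> *\<^sub>R u - y"
    by (auto simp: B_def)
  then have "x + (\<gamma> *\<^sub>R u - y) = 0" by (metis add.right_inverse)
  with \<open>u \<in> A x\<close> show ?thesis by (auto simp: add_diff_eq)
qed

text \<open>Solutions are the fixed points of a forward-backward map: a forward step on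
  \<open>M x - y\<close>, then the resolvent \<open>J\<close> of
  \<open>\<gamma> *\<^sub>R A\<close>. The resolvent is nonexpansive, and the forward step is a
  contraction for a suitable \<open>\<gamma>\<close>, so Banach's theorem applies.\<close>

theorem surj_sum_strongly_monotone:
  fixes A :: "'a::{real_inner,complete_space} \<Rightarrow> 'a set"
  assumes A: "maximal_monotone A" and "0 < \<mu>"
    and M: "\<And>x y. \<mu> * (norm (x - y))\<^sup>2 \<le> (M x - M y) \<bullet> (x - y)"
    and L: "\<And>x y. norm (M x - M y) \<le> L * norm (x - y)"
  shows "\<exists>x. y - M x \<in> A x"
proof -
  \<comment> \<open>Enlarging the Lipschitz constant to at least \<open>\<mu>\<close> makes it
    positive and keeps \<open>1 - \<mu>\<^sup>2 / K\<^sup>2\<close> nonnegative.\<close>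
  define K where "K = max L \<mu>"
  have K: "\<mu> \<le> K" "0 < K" "norm (M x - M y) \<le> K * norm (x - y)" for x y
    using L[of x y] \<open>0 < \<mu>\<close> mult_right_mono[of L K "norm (x - y)"] by (auto simp: K_def)
  \<comment> \<open>This step size minimises
    \<open>1 - 2 * \<gamma> * \<mu> + \<gamma>\<^sup>2 * K\<^sup>2\<close>, the bound for the
    squared contraction factor; the minimum is \<open>q\<^sup>2\<close> below.\<close>
  define \<gamma> where "\<gamma> = \<mu> / K\<^sup>2"
  have \<gamma>: "0 < \<gamma>" using K \<open>0 < \<mu>\<close> by (simp add: \<gamma>_def)
  have "\<forall>z. \<exists>x. \<exists>u\<in>A x. x + \<gamma> *\<^sub>R u = z" using minty[OF A \<gamma>] by blast
  then obtain J U where J: "\<And>z. U z \<in> A (J z)" "\<And>z. J z + \<gamma> *\<^sub>R U z = z" by metis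
  have nonexp: "norm (J z - J z') \<le> norm (z - z')" for z z'
  proof -
    have "0 \<le> \<gamma> * ((U z - U z') \<bullet> (J z - J z'))"
      using maximal_monotoneD[OF A J(1) J(1)] \<gamma> by simp
    also have "\<dots> = (\<gamma> *\<^sub>R U z - \<gamma> *\<^sub>R U z') \<bullet> (J z - J z')"
      by (simp add: inner_diff_left right_diff_distrib)
    also have "\<dots> = (z - z' - (J z - J z')) \<bullet> (J z - J z')"
    proof -
      have "\<gamma> *\<^sub>R U w = w - J w" for w using J(2)[of w] by (simp only: eq_diff_eq add.commute)
      then have "\<gamma> *\<^sub>R U z - \<gamma> *\<^sub>R U z' = z - z' - (J z - J z')" by simp
      then show ?thesis by (rule arg_cong)
    qed
    finally have "(norm (J z - J z'))\<^sup>2 \<le> norm (z - z') * norm (J z - J z')"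
      using norm_cauchy_schwarz[of "z - z'" "J z - J z'"] by (simp add: power2_norm_eq_inner inner_diff_left)
    then show ?thesis
      by (cases "norm (J z - J z') = 0") (simp_all add: power2_eq_square)
  qed
  define q where "q = sqrt (1 - \<mu>\<^sup>2 / K\<^sup>2)"
  have "\<mu>\<^sup>2 / K\<^sup>2 \<le> 1" using K \<open>0 < \<mu>\<close> by (simp add: power_mono)
  then have q: "0 \<le> q" "q < 1" "q\<^sup>2 = 1 - \<mu>\<^sup>2 / K\<^sup>2" using K \<open>0 < \<mu>\<close> by (simp_all add: q_def)
  define T where "T x = J (x - \<gamma> *\<^sub>R (M x - y))" for x
  have "dist (T x) (T x') \<le> q * dist x x'" for x x'
  proof -
    let ?d = "x - x'" and ?m = "M x - M x'"
    have "norm (T x - T x') \<le> norm (?d - \<gamma> *\<^sub>R ?m)"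
      using nonexp[of "x - \<gamma> *\<^sub>R (M x - y)" "x' - \<gamma> *\<^sub>R (M x' - y)"]
      by (simp add: T_def algebra_simps)
    moreover have "norm (?d - \<gamma> *\<^sub>R ?m) \<le> q * norm ?d"
    proof (rule power2_le_imp_le)
      have "(norm (?d - \<gamma> *\<^sub>R ?m))\<^sup>2 = (norm ?d)\<^sup>2 - 2 * \<gamma> * (?m \<bullet> ?d) + \<gamma>\<^sup>2 * (norm ?m)\<^sup>2"
        unfolding power2_norm_eq_inner inner_diff_left[of ?d] inner_diff_right[of _ ?d]
        by (simp add: inner_commute power2_eq_square algebra_simps)
      also have "\<dots> \<le> (norm ?d)\<^sup>2 - 2 * \<gamma> * (\<mu> * (norm ?d)\<^sup>2) + \<gamma>\<^sup>2 * (K * norm ?d)\<^sup>2"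
        using M[of x x'] K(3)[of x x'] \<gamma> by (intro add_mono diff_mono mult_left_mono power_mono) auto
      also have "\<dots> = (q * norm ?d)\<^sup>2"
        using \<open>0 < K\<close> unfolding power_mult_distrib q(3) \<gamma>_def by (simp add: field_simps power2_eq_square)
      finally show "(norm (?d - \<gamma> *\<^sub>R ?m))\<^sup>2 \<le> (q * norm ?d)\<^sup>2" .
    qed (use q in auto)
    ultimately show ?thesis by (simp add: dist_norm)
  qed
  then obtain x where "T x = x" using banach_fix_type[of q T] q by blast
  then have "U (x - \<gamma> *\<^sub>R (M x - y)) \<in> A x" "x + \<gamma> *\<^sub>R U (x - \<gamma> *\<^sub>R (M x - y)) = x - \<gamma> *\<^sub>R (M x - y)"
    using J[of "x - \<gamma> *\<^sub>R (M x - y)"] by (auto simp: T_def)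
  moreover from this(2) have "\<gamma> *\<^sub>R U (x - \<gamma> *\<^sub>R (M x - y)) = \<gamma> *\<^sub>R (y - M x)"
    by (simp add: algebra_simps)
  then have "U (x - \<gamma> *\<^sub>R (M x - y)) = y - M x" using \<gamma> by simp
  ultimately show ?thesis by auto
qed

section \<open>Weak cluster points\<close>

text \<open>The image filter has a cluster point by compactness; pulling its neighbourhoods back
  along \<open>f\<close> and intersecting with \<open>F\<close> gives \<open>G\<close>. Filters
  replace subsequences, since a compact set need not be sequentially compact.\<close>

lemma filter_cluster_point:
  assumes "compact K" and "F \<noteq> bot" and "\<forall>\<^sub>F k in F. f k \<in> K"
  obtains \<phi> G where "\<phi> \<in> K" "G \<noteq> bot" "G \<le> F" "(f \<longlongrightarrow> \<phi>) G"
proof -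
  have "filtermap f F \<noteq> bot" "\<forall>\<^sub>F u in filtermap f F. u \<in> K"
    using assms(2,3) by (auto simp: filtermap_bot_iff eventually_filtermap)
  then obtain \<phi> where \<phi>: "\<phi> \<in> K" "inf (nhds \<phi>) (filtermap f F) \<noteq> bot"
    using assms(1) unfolding compact_filter by blast
  define G where "G = inf (filtercomap f (nhds \<phi>)) F"
  have "G \<noteq> bot"
  proof
    assume "G = bot"
    then have "eventually (\<lambda>_. False) G" by simp
    then obtain P Q where PQ: "eventually P (nhds \<phi>)" "eventually Q F" "\<And>k. P (f k) \<Longrightarrow> \<not> Q k"
      unfolding G_def eventually_inf eventually_filtercomap by blast
    then have "\<forall>\<^sub>F u in filtermap f F. \<not> P u"
      unfolding eventually_filtermap by (auto elim: eventually_mono)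
    with PQ(1) have "eventually (\<lambda>_. False) (inf (nhds \<phi>) (filtermap f F))"
      unfolding eventually_inf by blast
    with \<phi>(2) show False by (simp add: trivial_limit_def)
  qed
  moreover have "(f \<longlongrightarrow> \<phi>) G"
    unfolding G_def by (rule filterlim_mono[OF filterlim_filtercomap order_refl inf_le1])
  ultimately show ?thesis using \<phi>(1) that[of \<phi> G] by (simp add: G_def)
qed

text \<open>The functionals \<open>x k \<bullet> _\<close> lie in a product of compact intervals, so Tychonoff replaces the
  usual extraction of a weakly convergent subsequence.\<close>

lemma weak_cluster_point:
  fixes x :: "'i \<Rightarrow> 'a::{real_inner,complete_space}"
  assumes "F \<noteq> bot" and R: "\<And>k. norm (x k) \<le> R"
  shows "\<exists>l G. G \<noteq> bot \<and> G \<le> F \<and> (\<forall>y. ((\<lambda>k. x k \<bullet> y) \<longlongrightarrow> l \<bullet> y) G)"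
proof -
  define K where "K = (\<Pi>\<^sub>E y\<in>UNIV. {- (R * norm y)..R * norm (y::'a)})"
  define f where "f k = (\<lambda>y. x k \<bullet> y)" for k
  have "compact K"
    using compactin_PiE[of "\<lambda>_. euclidean" UNIV "\<lambda>y. {- (R * norm y)..R * norm (y::'a)}"]
    by (simp add: K_def euclidean_product_topology)
  moreover have fK: "f k \<in> K" for k
  proof -
    have "\<bar>x k \<bullet> y\<bar> \<le> R * norm y" for y
      using Cauchy_Schwarz_ineq2[of "x k" y] mult_right_mono[OF R[of k], of "norm y"] by simp
    then show ?thesis by (auto simp: K_def f_def abs_le_iff minus_le_iff)
  qed
  ultimately obtain \<phi> G where \<phi>: "\<phi> \<in> K" and G: "G \<noteq> bot" "G \<le> F" "(f \<longlongrightarrow> \<phi>) G"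
    using filter_cluster_point[OF _ \<open>F \<noteq> bot\<close>, of K f] by auto
  have lim: "((\<lambda>k. x k \<bullet> y) \<longlongrightarrow> \<phi> y) G" for y
    using continuous_on_tendsto_compose[OF continuous_on_product_coordinates G(3), of y]
    by (simp add: f_def)
  \<comment> \<open>Pointwise limits along \<open>G\<close> inherit linearity, and membership in
    \<open>K\<close> supplies the bound, so the Riesz representation yields the weak limit.\<close>
  have "bounded_linear \<phi>"
  proof (rule bounded_linear_intro)
    show "\<phi> (y + z) = \<phi> y + \<phi> z" for y z
      using tendsto_unique[OF G(1) lim] tendsto_add[OF lim lim] by (fastforce simp: inner_add_right)
    show "\<phi> (r *\<^sub>R y) = r *\<^sub>R \<phi> y" for r y
      using tendsto_unique[OF G(1) lim[of "r *\<^sub>R y"]] tendsto_mult_left[OF lim[of y], of r] by simp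
    show "norm (\<phi> y) \<le> norm y * R" for y
      using \<phi> by (auto simp: K_def PiE_iff abs_le_iff mult.commute minus_le_iff)
  qed
  then obtain l where "\<And>y. \<phi> y = l \<bullet> y" by (rule riesz_representation) blast
  with G lim show ?thesis by auto
qed

text \<open>If convergence failed against some \<open>y\<close>, the indices at distance at least
  \<open>e\<close> would carry a nontrivial filter \<open>F\<close>. A weak cluster point along
  \<open>F\<close> must be \<open>l\<close>, which contradicts the distance.\<close>

lemma weakly_converges_unique_cluster:
  fixes x :: "nat \<Rightarrow> 'a::{real_inner,complete_space}"
  assumes R: "\<And>k. norm (x k) \<le> R"
    and unique: "\<And>G l'. G \<noteq> bot \<Longrightarrow> G \<le> sequentially \<Longrightarrow>
      (\<And>y. ((\<lambda>k. x k \<bullet> y) \<longlongrightarrow> l' \<bullet> y) G) \<Longrightarrow> l' = l"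
  shows "weakly_converges x l"
  unfolding weakly_converges_def
proof (intro allI tendstoI, rule ccontr)
  fix y and e :: real assume "0 < e" and not: "\<not> (\<forall>\<^sub>F k in sequentially. dist (x k \<bullet> y) (l \<bullet> y) < e)"
  define F where "F = inf sequentially (principal {k. \<not> dist (x k \<bullet> y) (l \<bullet> y) < e})"
  have "F \<noteq> bot"
    using not by (simp add: F_def trivial_limit_def eventually_inf_principal)
  then obtain l' G where G: "G \<noteq> bot" "G \<le> F" "\<And>y. ((\<lambda>k. x k \<bullet> y) \<longlongrightarrow> l' \<bullet> y) G"
    using weak_cluster_point[of F x R] R by blast
  have "l' = l" using G by (intro unique) (auto simp: F_def)
  have "\<forall>\<^sub>F k in G. dist (x k \<bullet> y) (l \<bullet> y) < e"
    using G(3)[of y] \<open>0 < e\<close> unfolding \<open>l' = l\<close> by (rule tendstoD)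
  moreover have "\<forall>\<^sub>F k in G. \<not> dist (x k \<bullet> y) (l \<bullet> y) < e"
    using G(2) by (rule filter_leD) (simp add: F_def eventually_inf_principal)
  ultimately have "eventually (\<lambda>_. False) G" by eventually_elim simp
  then show False using G(1) by (simp add: trivial_limit_def)
qed

section \<open>Positive definite operators and cocoercivity\<close>

lemma posdef_diff: "S \<in> posdef_ops \<Longrightarrow> S (x - y) = S x - S y"
  and posdef_add: "S \<in> posdef_ops \<Longrightarrow> S (x + y) = S x + S y"
  and posdef_scaleR: "S \<in> posdef_ops \<Longrightarrow> S (r *\<^sub>R x) = r *\<^sub>R S x"
  by (auto simp: posdef_ops_def bounded_linear.linear linear_diff linear_add linear_scale)

lemma posdef_sym: "S \<in> posdef_ops \<Longrightarrow> S x \<bullet> y = x \<bullet> S y"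
  by (simp add: posdef_ops_def)

lemma posdef_bounds:
  assumes "S \<in> posdef_ops"
  shows "\<exists>l>0. \<exists>u>0. \<forall>x. l * (norm x)\<^sup>2 \<le> x \<bullet> S x \<and> x \<bullet> S x \<le> u * (norm x)\<^sup>2"
  using assms unfolding posdef_ops_def mem_Collect_eq by (meson less_le_trans)

lemma posdef_nonneg: "S \<in> posdef_ops \<Longrightarrow> 0 \<le> x \<bullet> S x"
  using posdef_bounds[of S] by (meson less_imp_le mult_nonneg_nonneg order_trans zero_le_power2)

lemma posdef_eq_0:
  assumes "S \<in> posdef_ops" "x \<bullet> S x \<le> 0"
  shows "x = 0"
proof -
  obtain l where l: "0 < l" "l * (norm x)\<^sup>2 \<le> x \<bullet> S x" using posdef_bounds[OF assms(1)] by blast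
  then have "l * (norm x)\<^sup>2 \<le> 0" using assms(2) by linarith
  then show ?thesis using l(1) by (simp add: mult_le_0_iff)
qed

lemma wnorm_power2: "S \<in> posdef_ops \<Longrightarrow> (wnorm S x)\<^sup>2 = x \<bullet> S x"
  by (simp add: wnorm_def posdef_nonneg)

lemma posdef_inner_add:
  "S \<in> posdef_ops \<Longrightarrow> (x + y) \<bullet> S (x + y) = x \<bullet> S x + 2 * (x \<bullet> S y) + y \<bullet> S y"
  using posdef_sym[of S x y] by (simp add: posdef_add inner_add inner_commute)

text \<open>With the zero operator, \<open>surj_sum_strongly_monotone\<close> becomes solvability of
  a plain equation, as needed for \<open>posdef_surj\<close>.\<close>

lemma maximal_monotone_const_0: "maximal_monotone (\<lambda>_. {0})"
  unfolding maximal_monotone_iff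
proof (intro conjI allI impI)
  show "monotone_op (\<lambda>_. {0})" by (simp add: monotone_op_def)
  fix x y :: 'a assume "\<forall>a. \<forall>u\<in>{0}. 0 \<le> (y - u) \<bullet> (x - a)"
  \<comment> \<open>The test point \<open>x + y\<close> turns the relation into
    \<open>0 \<le> - (y \<bullet> y)\<close>.\<close>
  then have "0 \<le> y \<bullet> (x - (x + y))" by (metis diff_zero singletonI)
  then have "y \<bullet> y = 0" using inner_ge_zero[of y] by simp
  then show "y \<in> {0}" by simp
qed

text \<open>The lower bound makes \<open>S\<close> strongly monotone and boundedness makes it
  Lipschitz, so \<open>S x = y\<close> is solvable. This makes \<open>inv S\<close> a genuine right
  inverse.\<close>

lemma posdef_surj:
  fixes S :: "'a::{real_inner,complete_space} \<Rightarrow> 'a"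
  assumes S: "S \<in> posdef_ops"
  shows "surj S"
proof -
  obtain l where l: "0 < l" "\<And>x. l * (norm x)\<^sup>2 \<le> x \<bullet> S x" using posdef_bounds[OF S] by blast
  have "bounded_linear S" using S by (simp add: posdef_ops_def)
  then obtain K where K: "\<And>x. norm (S x) \<le> norm x * K" using bounded_linear.bounded by blast
  have "\<exists>x. y - S x \<in> {0}" for y
    using maximal_monotone_const_0 l(1)
  proof (rule surj_sum_strongly_monotone)
    fix x y
    show "l * (norm (x - y))\<^sup>2 \<le> (S x - S y) \<bullet> (x - y)"
      using l(2)[of "x - y"] by (simp add: posdef_diff[OF S] inner_commute)
    show "norm (S x - S y) \<le> K * norm (x - y)"
      using K[of "x - y"] by (simp add: posdef_diff[OF S] mult.commute)
  qed
  then show ?thesis by (metis eq_iff_diff_eq_0 singletonD surjI)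
qed

section \<open>Projections in the weighted norm\<close>

text \<open>The variational inequality says that moving from \<open>p\<close> towards any
  \<open>z\<close> in \<open>H\<close> does not decrease the distance to first order; convexity
  keeps such moves inside \<open>H\<close>.\<close>

lemma proj_set_convex_iff:
  assumes S: "S \<in> posdef_ops" and "convex H"
  shows "p \<in> proj_set S H x \<longleftrightarrow> p \<in> H \<and> (\<forall>z\<in>H. (x - p) \<bullet> S (z - p) \<le> 0)"
proof -
  have expand: "(x - (p + r *\<^sub>R v)) \<bullet> S (x - (p + r *\<^sub>R v)) =
      (x - p) \<bullet> S (x - p) - 2 * r * ((x - p) \<bullet> S v) + r\<^sup>2 * (v \<bullet> S v)" for r v
    using posdef_inner_add[OF S, of "x - p" "(- r) *\<^sub>R v"]
    by (simp only: posdef_scaleR[OF S] inner_scaleR_right inner_scaleR_left)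
       (simp add: algebra_simps power2_eq_square)
  have "p \<in> proj_set S H x \<longleftrightarrow> p \<in> H \<and> (\<forall>z\<in>H. (x - p) \<bullet> S (x - p) \<le> (x - z) \<bullet> S (x - z))"
    by (auto simp: proj_set_def is_arg_min_def wnorm_def not_less)
  also have "\<dots> \<longleftrightarrow> p \<in> H \<and> (\<forall>z\<in>H. (x - p) \<bullet> S (z - p) \<le> 0)"
  proof (intro conj_cong refl iffI ballI)
    fix z assume "p \<in> H" "z \<in> H" and min: "\<forall>z\<in>H. (x - p) \<bullet> S (x - p) \<le> (x - z) \<bullet> S (x - z)"
    show "(x - p) \<bullet> S (z - p) \<le> 0"
    proof (rule ccontr)
      define a where "a = (x - p) \<bullet> S (z - p)"
      define b where "b = (z - p) \<bullet> S (z - p)"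
      \<comment> \<open>Moving by \<open>r\<close> changes the squared distance by
        \<open>r * (r * b - 2 * a)\<close>, which is negative once \<open>r * b \<le> a\<close>. The
        denominator \<open>a + b\<close> also ensures \<open>r \<le> 1\<close> and covers
        \<open>b = 0\<close>.\<close>
      define r where "r = a / (a + b)"
      assume "\<not> ?thesis"
      then have "0 < a" "0 \<le> b" using posdef_nonneg[OF S] by (simp_all add: a_def b_def)
      then have r: "0 < r" "r \<le> 1" "r * b \<le> a" by (simp_all add: r_def field_simps)
      have "(1 - r) *\<^sub>R p + r *\<^sub>R z \<in> H"
        using \<open>convex H\<close> \<open>p \<in> H\<close> \<open>z \<in> H\<close> r by (intro convexD) auto
      then have "p + r *\<^sub>R (z - p) \<in> H" by (simp add: algebra_simps)
      from min[rule_format, OF this] have "r * (2 * a) \<le> r * (r * b)"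
        unfolding expand by (simp add: a_def b_def power2_eq_square algebra_simps)
      with r \<open>0 < a\<close> show False by simp
    qed
  next
    fix z assume "\<forall>z\<in>H. (x - p) \<bullet> S (z - p) \<le> 0" "z \<in> H"
    then show "(x - p) \<bullet> S (x - p) \<le> (x - z) \<bullet> S (x - z)"
      using expand[of 1 "z - p"] posdef_nonneg[OF S, of "z - p"] by fastforce
  qed
  finally show ?thesis .
qed

lemma proj_set_unique:
  assumes S: "S \<in> posdef_ops" and "convex H" "p \<in> proj_set S H x" "q \<in> proj_set S H x"
  shows "p = q"
proof -
  have "(x - p) \<bullet> S (q - p) \<le> 0" "(x - q) \<bullet> S (p - q) \<le> 0"
    using assms by (auto simp: proj_set_convex_iff)
  then have "(q - p) \<bullet> S (q - p) \<le> 0"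
    by (simp add: posdef_diff[OF S] inner_diff)
  then show ?thesis using posdef_eq_0[OF S] by fastforce
qed

text \<open>The projection is explicit: outside points move along \<open>w\<close>, the normal
  \<open>v\<close> transported by the inverse of \<open>S\<close>, until they reach the bounding
  hyperplane.\<close>

lemma proj_set_halfspace_nonempty:
  fixes S :: "'a::{real_inner,complete_space} \<Rightarrow> 'a"
  assumes S: "S \<in> posdef_ops" and "0 \<le> b"
  shows "proj_set S {z. v \<bullet> (z - a) \<le> b} x \<noteq> {}"
proof -
  let ?H = "{z. v \<bullet> (z - a) \<le> b}"
  have cv: "convex ?H"
    using convex_halfspace_le[of v "b + v \<bullet> a"] by (simp add: inner_diff_right diff_le_eq)
  show ?thesis
  proof (cases "x \<in> ?H")
    case True
    then have "x \<in> proj_set S ?H x" by (simp add: proj_set_convex_iff[OF S cv])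
    then show ?thesis by blast
  next
    case False
    obtain w where w: "S w = v" using posdef_surj[OF S] by (metis surjD)
    \<comment> \<open>If \<open>w\<close> vanished, so would \<open>v\<close>, and
      \<open>0 \<le> b\<close> would put \<open>x\<close> into the halfspace.\<close>
    have "w \<noteq> 0" using False \<open>0 \<le> b\<close> w posdef_scaleR[OF S, of 0 0] by auto
    then have vw: "0 < v \<bullet> w" using posdef_eq_0[OF S, of w] w by (fastforce simp: inner_commute not_le)
    define r where "r = (v \<bullet> (x - a) - b) / (v \<bullet> w)"
    have r: "0 \<le> r" using False vw by (simp add: r_def)
    define p where "p = x - r *\<^sub>R w"
    have "v \<bullet> (p - a) = b"
      using vw by (simp add: p_def r_def inner_diff_right)
    moreover have "(x - p) \<bullet> S (z - p) \<le> 0" if "z \<in> ?H" for z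
    proof -
      have "(x - p) \<bullet> S (z - p) = r * (v \<bullet> (z - p))"
        using posdef_sym[OF S, of w "z - p"] by (simp add: p_def w)
      also have "v \<bullet> (z - p) = v \<bullet> (z - a) - v \<bullet> (p - a)" by (simp add: inner_diff_right)
      finally show ?thesis using that r \<open>v \<bullet> (p - a) = b\<close> by (simp add: mult_nonneg_nonpos)
    qed
    ultimately have "p \<in> proj_set S ?H x" by (simp add: proj_set_convex_iff[OF S cv])
    then show ?thesis by blast
  qed
qed

text \<open>In the expansion of the squared distance from \<open>y\<close> to \<open>z\<close>, the
  variational inequality bounds the cross term by minus the squared projection step. The total
  coefficient of that square becomes \<open>t\<^sup>2 - 2 * t\<close>.\<close>

lemma relaxed_projection_fejer:
  assumes S: "S \<in> posdef_ops" and "convex H" "p \<in> proj_set S H x" "z \<in> H" "0 \<le> t"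
    and y: "y = (1 - t) *\<^sub>R x + t *\<^sub>R p"
  shows "(y - z) \<bullet> S (y - z) \<le> (x - z) \<bullet> S (x - z) - t * (2 - t) * ((p - x) \<bullet> S (p - x))"
proof -
  have yz: "y - z = (x - z) + t *\<^sub>R (p - x)" by (simp add: y algebra_simps)
  have "(x - p) \<bullet> S (z - p) \<le> 0" using assms by (simp add: proj_set_convex_iff)
  then have "(x - z) \<bullet> S (p - x) \<le> - ((p - x) \<bullet> S (p - x))"
    using posdef_sym[OF S, of x p] posdef_sym[OF S, of z p] posdef_sym[OF S, of z x]
    by (simp add: posdef_diff[OF S] inner_diff inner_commute)
  then have "2 * t * ((x - z) \<bullet> S (p - x)) \<le> 2 * t * (- ((p - x) \<bullet> S (p - x)))"
    using \<open>0 \<le> t\<close> by (intro mult_left_mono) auto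
  then show ?thesis
    unfolding yz posdef_inner_add[OF S] posdef_scaleR[OF S] inner_scaleR_left inner_scaleR_right
    by (simp add: algebra_simps power2_eq_square)
qed

section \<open>Consequences of cocoercivity\<close>

text \<open>Write \<open>z - y = (x - y) - (x - z)\<close>. Cocoercivity controls the pairing with
  \<open>x - z\<close>, and Young's inequality the one with \<open>x - y\<close>; the terms in
  \<open>w \<bullet> P w / \<beta>\<close> cancel.\<close>

lemma cocoercive_quadratic_bound:
  fixes P :: "'a::{real_inner,complete_space} \<Rightarrow> 'a"
  assumes P: "P \<in> posdef_ops" and "0 \<le> \<beta>" and C: "cocoercive_wrt P \<beta> C"
  shows "(C x - C z) \<bullet> (z - y) \<le> \<beta> / 4 * (wnorm P (x - y))\<^sup>2"
proof (cases "\<beta> = 0")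
  case True
  then have "C x = C z" using C by (simp add: cocoercive_wrt_def)
  then show ?thesis using True by simp
next
  case False
  then have \<beta>: "0 < \<beta>" using \<open>0 \<le> \<beta>\<close> by simp
  define w where "w = inv P (C x - C z)"
  have w: "P w = C x - C z" using posdef_surj[OF P] by (simp add: w_def surj_f_inv_f)
  have "(wnorm (inv P) (C x - C z))\<^sup>2 = w \<bullet> P w"
    using posdef_nonneg[OF P, of w] by (simp add: wnorm_def w inner_commute flip: w_def)
  then have c: "w \<bullet> P w / \<beta> \<le> P w \<bullet> (x - z)"
    using C False by (simp add: cocoercive_wrt_def w divide_inverse) (metis mult.commute)
  \<comment> \<open>Young's inequality with the weight that makes the coefficient of
    \<open>w \<bullet> P w\<close> exactly \<open>1 / \<beta>\<close>, as in the cocoercivity bound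
    \<open>c\<close>.\<close>
  have "0 \<le> (w + (- (\<beta> / 2)) *\<^sub>R (x - y)) \<bullet> P (w + (- (\<beta> / 2)) *\<^sub>R (x - y)) / \<beta>"
    using posdef_nonneg[OF P] \<beta> by simp
  also have "\<dots> = w \<bullet> P w / \<beta> - w \<bullet> P (x - y) + \<beta> / 4 * ((x - y) \<bullet> P (x - y))"
    unfolding posdef_inner_add[OF P] posdef_scaleR[OF P] inner_scaleR_left inner_scaleR_right
    using \<beta> by (simp add: field_simps)
  finally show ?thesis
    using c posdef_sym[OF P, of w "x - y"] unfolding wnorm_power2[OF P] w[symmetric]
    by (simp add: inner_diff_right)
qed

lemma cocoercive_monotone:
  fixes P :: "'a::{real_inner,complete_space} \<Rightarrow> 'a"
  assumes "0 \<le> \<beta>" and C: "cocoercive_wrt P \<beta> C"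
  shows "0 \<le> (C x - C y) \<bullet> (x - y)"
proof (cases "\<beta> = 0")
  case True
  then have "C x = C y" using C by (simp add: cocoercive_wrt_def)
  then show ?thesis by simp
next
  case False
  have "0 \<le> 1 / \<beta> * (wnorm (inv P) (C x - C y))\<^sup>2" using assms(1) by simp
  also have "\<dots> \<le> (C x - C y) \<bullet> (x - y)" using C False by (simp add: cocoercive_wrt_def)
  finally show ?thesis .
qed

text \<open>With \<open>w\<close> the preimage of \<open>C x - C y\<close> under \<open>P\<close>,
  cocoercivity and Cauchy-Schwarz give \<open>l * (norm w)\<^sup>2 \<le> \<beta> * (norm (P w) *
  norm (x - y))\<close>. Since \<open>norm (P w) \<le> norm w * B\<close>, one factor
  \<open>norm (P w)\<close> can be cancelled.\<close>

lemma cocoercive_lipschitz: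
  fixes P :: "'a::{real_inner,complete_space} \<Rightarrow> 'a"
  assumes P: "P \<in> posdef_ops" and "0 \<le> \<beta>" and C: "cocoercive_wrt P \<beta> C"
  shows "\<exists>K\<ge>0. \<forall>x y. norm (C x - C y) \<le> K * norm (x - y)"
proof (cases "\<beta> = 0")
  case True
  then have "norm (C x - C y) \<le> 0 * norm (x - y)" for x y using C by (simp add: cocoercive_wrt_def)
  then show ?thesis by blast
next
  case False
  then have \<beta>: "0 < \<beta>" using \<open>0 \<le> \<beta>\<close> by simp
  obtain l where l: "0 < l" "\<And>x. l * (norm x)\<^sup>2 \<le> x \<bullet> P x" using posdef_bounds[OF P] by blast
  have "bounded_linear P" using P by (simp add: posdef_ops_def)
  then obtain B where B: "0 < B" "\<And>x. norm (P x) \<le> norm x * B"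
    using bounded_linear.pos_bounded by blast
  have "norm (C x - C y) \<le> \<beta> * B\<^sup>2 / l * norm (x - y)" for x y
  proof -
    define w where "w = inv P (C x - C y)"
    have w: "P w = C x - C y" using posdef_surj[OF P] by (simp add: w_def surj_f_inv_f)
    have "(wnorm (inv P) (C x - C y))\<^sup>2 = w \<bullet> P w"
      using posdef_nonneg[OF P, of w] by (simp add: wnorm_def w inner_commute flip: w_def)
    moreover have "1 / \<beta> * (wnorm (inv P) (C x - C y))\<^sup>2 \<le> (C x - C y) \<bullet> (x - y)"
      using C False by (simp add: cocoercive_wrt_def)
    ultimately have "w \<bullet> P w \<le> \<beta> * (P w \<bullet> (x - y))"
      using \<beta> by (simp add: w field_simps)
    also have "P w \<bullet> (x - y) \<le> norm (P w) * norm (x - y)" by (rule norm_cauchy_schwarz)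
    finally have "l * (norm w)\<^sup>2 \<le> \<beta> * (norm (P w) * norm (x - y))"
      using l(2)[of w] \<beta> by simp
    moreover have "(norm (P w))\<^sup>2 \<le> (norm w)\<^sup>2 * B\<^sup>2"
      using power_mono[OF B(2)[of w], of 2] by (simp add: power_mult_distrib)
    ultimately have "l * (norm (P w))\<^sup>2 \<le> B\<^sup>2 * (\<beta> * (norm (P w) * norm (x - y)))"
      using l(1) by (smt (verit) mult.assoc mult.commute mult_left_mono zero_le_power2)
    then have "norm (P w) * norm (P w) \<le> norm (P w) * (\<beta> * B\<^sup>2 / l * norm (x - y))"
      using l(1) by (simp add: field_simps power2_eq_square)
    moreover have "0 \<le> \<beta> * B\<^sup>2 / l * norm (x - y)" using \<beta> l(1) by simp
    ultimately show ?thesis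
      unfolding w[symmetric] by (metis mult_left_le_imp_le norm_ge_zero order_less_le)
  qed
  moreover have "0 \<le> \<beta> * B\<^sup>2 / l" using \<beta> l(1) by simp
  ultimately show ?thesis by blast
qed

section \<open>Nonlinear forward-backward splitting\<close>

lemma zer_op_sum_iff: "z \<in> zer (op_sum A (\<lambda>x. {C x})) \<longleftrightarrow> - C z \<in> A z"
  by (auto simp: zer_def op_sum_def add_eq_0_iff2)

lemma op_inverse_op_sum_iff: "x \<in> op_inverse (op_sum (\<lambda>y. {M y}) A) u \<longleftrightarrow> u - M x \<in> A x"
  by (auto simp: op_inverse_def op_sum_def) (metis add_diff_cancel_left' add.commute diff_add_cancel)

section \<open>Well-definedness of the iteration\<close>

text \<open>Positive definiteness of \<open>P\<close> turns strong monotonicity in its norm into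
  strong monotonicity in the original norm, which gives existence. Monotonicity of \<open>A\<close>
  forces two solutions to coincide.\<close>

lemma resolvent_ex1:
  fixes A :: "'a::{real_inner,complete_space} \<Rightarrow> 'a set"
  assumes A: "maximal_monotone A" and P: "P \<in> posdef_ops"
    and M: "strongly_monotone_wrt P 1 M" and L: "L-lipschitz_on UNIV M"
  shows "\<exists>!x. x \<in> op_inverse (op_sum (\<lambda>y. {M y}) A) u"
  unfolding op_inverse_op_sum_iff
proof (rule ex_ex1I)
  obtain l where l: "0 < l" "\<And>x. l * (norm x)\<^sup>2 \<le> x \<bullet> P x" using posdef_bounds[OF P] by blast
  have sm: "(x - y) \<bullet> P (x - y) \<le> (M x - M y) \<bullet> (x - y)" for x y
    using M by (simp add: strongly_monotone_wrt_def wnorm_power2[OF P])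
  show "\<exists>x. u - M x \<in> A x"
    using A l(1)
  proof (rule surj_sum_strongly_monotone)
    show "l * (norm (x - y))\<^sup>2 \<le> (M x - M y) \<bullet> (x - y)" for x y
      using l(2)[of "x - y"] sm[of x y] by linarith
    show "norm (M x - M y) \<le> L * norm (x - y)" for x y
      using lipschitz_onD[OF L, of x y] by (simp add: dist_norm)
  qed
  fix x y assume "u - M x \<in> A x" "u - M y \<in> A y"
  then have "0 \<le> ((u - M x) - (u - M y)) \<bullet> (x - y)"
    by (rule maximal_monotoneD[OF A])
  then have "(M x - M y) \<bullet> (x - y) \<le> 0" by (simp add: inner_diff_left)
  with sm[of x y] have "(x - y) \<bullet> P (x - y) \<le> 0" by linarith
  then have "x - y = 0" by (rule posdef_eq_0[OF P])
  then show "x = y" by simp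
qed

lemma convex_nofob_halfspace: "convex (nofob_halfspace P \<beta> M x y)"
  unfolding nofob_halfspace_def inner_diff_right diff_le_eq by (rule convex_halfspace_le)

lemma nofob_projection_ex1:
  fixes S :: "'a::{real_inner,complete_space} \<Rightarrow> 'a"
  assumes S: "S \<in> posdef_ops" and "0 \<le> \<beta>"
  shows "\<exists>!p. p \<in> proj_set S (nofob_halfspace P \<beta> M x y) x"
proof (rule ex_ex1I)
  show "\<exists>p. p \<in> proj_set S (nofob_halfspace P \<beta> M x y) x"
    using proj_set_halfspace_nonempty[OF S, of "\<beta> / 4 * (wnorm P (x - y))\<^sup>2" "M x - M y" y x] \<open>0 \<le> \<beta>\<close>
    by (auto simp: nofob_halfspace_def)
qed (rule proj_set_unique[OF S convex_nofob_halfspace])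

text \<open>Uniqueness of both steps turns the relations into functions \<open>J\<close> and
  \<open>Q\<close>, so the predicate becomes a recursion. Quantifying over the pair \<open>s\<close>
  expresses joint uniqueness of the two sequences.\<close>

lemma nofob_iterates_ex1:
  assumes res: "\<And>k u. \<exists>!y. y \<in> op_inverse (op_sum (\<lambda>y. {M k y}) A) u"
    and proj: "\<And>k x y. \<exists>!p. p \<in> proj_set S (nofob_halfspace P \<beta> (M k) x y) x"
  shows "\<exists>!s. nofob_iterates P S \<beta> A C M \<theta> x0 (fst s) (snd s)"
proof -
  obtain J where J: "\<And>k u y. y \<in> op_inverse (op_sum (\<lambda>y. {M k y}) A) u \<longleftrightarrow> y = J k u"
    using res by metis
  obtain Q where Q': "\<And>k x y p. p \<in> proj_set S (nofob_halfspace P \<beta> (M k) x y) x \<longleftrightarrow> p = Q k x y"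
    using proj by metis
  have Q: "proj_set S (nofob_halfspace P \<beta> (M k) x y) x = {Q k x y}" for k x y
    using Q' by blast
  define f where "f k x = (1 - \<theta> k) *\<^sub>R x + \<theta> k *\<^sub>R Q k x (J k (M k x - C x))" for k x
  define X where "X = rec_nat x0 f"
  define Y where "Y k = J k (M k (X k) - C (X k))" for k
  have "nofob_iterates P S \<beta> A C M \<theta> x0 x y \<longleftrightarrow>
      x 0 = x0 \<and> (\<forall>k. y k = J k (M k (x k) - C (x k)) \<and> x (Suc k) = f k (x k))" for x y
    unfolding nofob_iterates_def J Q by (auto simp: f_def)
  also have "\<dots> x y \<longleftrightarrow> x = X \<and> y = Y" for x y
  proof (intro iffI conjI)
    assume *: "x 0 = x0 \<and> (\<forall>k. y k = J k (M k (x k) - C (x k)) \<and> x (Suc k) = f k (x k))"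
    have "x k = X k" for k by (induction k) (use * in \<open>simp_all add: X_def\<close>)
    then show "x = X" by blast
    then show "y = Y" using * by (auto simp: Y_def)
  qed (auto simp: X_def Y_def)
  finally have "nofob_iterates P S \<beta> A C M \<theta> x0 x y \<longleftrightarrow> x = X \<and> y = Y" for x y .
  then show ?thesis by (intro ex1I[of _ "(X, Y)"]) (auto simp: prod_eq_iff)
qed

section \<open>Separating halfspaces and the resolvent distance\<close>

text \<open>Monotonicity of \<open>A\<close> is applied to \<open>M x - C x - M y\<close> at
  \<open>y\<close> and \<open>- C z\<close> at \<open>z\<close>. The remaining difference of
  \<open>C\<close> is exactly what \<open>cocoercive_quadratic_bound\<close> estimates.\<close>

lemma zer_subset_nofob_halfspace:
  fixes P :: "'a::{real_inner,complete_space} \<Rightarrow> 'a"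
  assumes A: "maximal_monotone A" and P: "P \<in> posdef_ops"
    and \<beta>: "0 \<le> \<beta>" and C: "cocoercive_wrt P \<beta> C"
    and y: "y \<in> op_inverse (op_sum (\<lambda>y. {M y}) A) (M x - C x)"
  shows "zer (op_sum A (\<lambda>x. {C x})) \<subseteq> nofob_halfspace P \<beta> M x y"
proof
  fix z assume "z \<in> zer (op_sum A (\<lambda>x. {C x}))"
  then have "0 \<le> ((M x - C x - M y) - (- C z)) \<bullet> (y - z)"
    using y unfolding zer_op_sum_iff op_inverse_op_sum_iff
    by (intro maximal_monotoneD[OF A])
  then have "(M x - M y) \<bullet> (z - y) \<le> (C x - C z) \<bullet> (z - y)"
    by (simp add: inner_diff inner_add)
  also have "\<dots> \<le> \<beta> / 4 * (wnorm P (x - y))\<^sup>2"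
    by (rule cocoercive_quadratic_bound[OF P \<beta> C])
  finally show "z \<in> nofob_halfspace P \<beta> M x y" by (simp add: nofob_halfspace_def)
qed

text \<open>Subtracting the halfspace inequality at \<open>p\<close> from strong monotonicity leaves
  a pairing with \<open>x - p\<close>. Both sides then contain \<open>x - y\<close>, so for
  \<open>\<beta> < 4\<close> the step \<open>x - p\<close> controls \<open>x - y\<close>.\<close>

lemma nofob_halfspace_distance:
  assumes P: "P \<in> posdef_ops" and M: "strongly_monotone_wrt P 1 M" and L: "L-lipschitz_on UNIV M"
    and p: "p \<in> nofob_halfspace P \<beta> M x y"
  shows "(1 - \<beta> / 4) * ((x - y) \<bullet> P (x - y)) \<le> L * norm (x - y) * norm (x - p)"
proof -
  have "(x - y) \<bullet> P (x - y) \<le> (M x - M y) \<bullet> (x - y)"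
    using M by (simp add: strongly_monotone_wrt_def wnorm_power2[OF P])
  moreover have "(M x - M y) \<bullet> (p - y) \<le> \<beta> / 4 * ((x - y) \<bullet> P (x - y))"
    using p by (simp add: nofob_halfspace_def wnorm_power2[OF P])
  ultimately have "(1 - \<beta> / 4) * ((x - y) \<bullet> P (x - y)) \<le> (M x - M y) \<bullet> (x - p)"
    by (simp add: inner_diff_right algebra_simps)
  also have "\<dots> \<le> norm (M x - M y) * norm (x - p)" by (rule norm_cauchy_schwarz)
  also have "\<dots> \<le> L * norm (x - y) * norm (x - p)"
    using lipschitz_onD[OF L, of x y] by (intro mult_right_mono) (simp_all add: dist_norm)
  finally show ?thesis .
qed

section \<open>Weak cluster points and Opial's argument\<close>

text \<open>Testing monotonicity at the solution \<open>a\<close> of \<open>z \<in> a + C a + A a\<close> forces \<open>z = a\<close>.\<close>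

lemma weak_cluster_point_in_zer:
  fixes A :: "'a::{real_inner,complete_space} \<Rightarrow> 'a set"
  assumes A: "maximal_monotone A"
    and mono: "\<And>x y. 0 \<le> (C x - C y) \<bullet> (x - y)"
    and lip: "\<And>x y. norm (C x - C y) \<le> K * norm (x - y)" and "0 \<le> K"
    and u: "\<And>k. u k \<in> A (y k)"
    and B: "\<And>k. norm (x k) \<le> B"
    and G: "G \<noteq> bot" and z: "\<And>v. ((\<lambda>k. x k \<bullet> v) \<longlongrightarrow> z \<bullet> v) G"
    and d: "((\<lambda>k. y k - x k) \<longlongrightarrow> 0) G" and r: "((\<lambda>k. u k + C (x k)) \<longlongrightarrow> 0) G"
  shows "z \<in> zer (op_sum A (\<lambda>x. {C x}))"
proof -
  \<comment> \<open>The identity plus the monotone Lipschitz \<open>C\<close> is strongly monotone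
    with constant 1 and Lipschitz with constant \<open>1 + K\<close>.\<close>
  have "\<exists>a. z - (a + C a) \<in> A a"
    using A zero_less_one
  proof (rule surj_sum_strongly_monotone)
    fix a b
    show "1 * (norm (a - b))\<^sup>2 \<le> (a + C a - (b + C b)) \<bullet> (a - b)"
      using mono[of a b] by (simp add: power2_norm_eq_inner inner_diff inner_add)
    have "a + C a - (b + C b) = (a - b) + (C a - C b)" by simp
    then show "norm (a + C a - (b + C b)) \<le> (1 + K) * norm (a - b)"
      using norm_triangle_ineq[of "a - b" "C a - C b"] lip[of a b]
      unfolding \<open>a + C a - (b + C b) = _\<close> by (simp add: distrib_right)
  qed
  then obtain a where a: "z - (a + C a) \<in> A a" by blast
  define b where "b = B + norm a"
  \<comment> \<open>Each summand is a bounded quantity times the norm of either the residual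
    \<open>u k + C (x k)\<close> or the gap \<open>y k - x k\<close>, so \<open>e\<close> vanishes
    along \<open>G\<close>.\<close>
  define e where "e k = norm (u k + C (x k)) * (b + norm (y k - x k)) + K * b * norm (y k - x k)
    + norm (z - a) * norm (y k - x k)" for k
  have xa: "norm (x k - a) \<le> b" for k
    using norm_triangle_ineq4[of "x k" a] B[of k] by (simp add: b_def)
  have bound: "(z - a) \<bullet> (x k - a) \<le> e k" for k
  proof -
    define R D where "R = u k + C (x k)" and "D = y k - x k"
    have uy: "u k = R - C (x k)" "y k = x k + D" by (simp_all add: R_def D_def)
    have "0 \<le> (u k - (z - (a + C a))) \<bullet> (y k - a)"
      using A u a by (rule maximal_monotoneD)
    also have "u k - (z - (a + C a)) = R - (C (x k) - C a) - (z - a)" by (simp add: uy)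
    also have "y k - a = (x k - a) + D" by (simp add: uy)
    also have "(R - (C (x k) - C a) - (z - a)) \<bullet> ((x k - a) + D) =
      R \<bullet> ((x k - a) + D) - (C (x k) - C a) \<bullet> (x k - a) - (C (x k) - C a) \<bullet> D
        - (z - a) \<bullet> (x k - a) - (z - a) \<bullet> D"
      by (simp only: inner_diff_left[of "R - (C (x k) - C a)"] inner_diff_left[of R] inner_add_right)
    finally have "(z - a) \<bullet> (x k - a) \<le> R \<bullet> ((x k - a) + D) - (C (x k) - C a) \<bullet> D - (z - a) \<bullet> D"
      using mono[of "x k" a] by linarith
    moreover have "R \<bullet> ((x k - a) + D) \<le> norm R * (b + norm D)"
      using norm_cauchy_schwarz[of R "(x k - a) + D"]
        mult_left_mono[OF order_trans[OF norm_triangle_ineq add_right_mono[OF xa]], of "norm R" k D]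
      by simp
    moreover have "- ((C (x k) - C a) \<bullet> D) \<le> K * b * norm D"
    proof -
      have "norm (C (x k) - C a) \<le> K * b"
        using lip[of "x k" a] mult_left_mono[OF xa[of k] \<open>0 \<le> K\<close>] by linarith
      then have "norm (C (x k) - C a) * norm D \<le> K * b * norm D" by (rule mult_right_mono) simp
      then show ?thesis using Cauchy_Schwarz_ineq2[of "C (x k) - C a" D] by linarith
    qed
    moreover have "- ((z - a) \<bullet> D) \<le> norm (z - a) * norm D"
      using Cauchy_Schwarz_ineq2[of "z - a" D] by linarith
    ultimately show ?thesis unfolding e_def R_def[symmetric] D_def[symmetric] by linarith
  qed
  have "(e \<longlongrightarrow> norm (0::'a) * (b + norm (0::'a)) + K * b * norm (0::'a) + norm (z - a) * norm (0::'a)) G"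
    unfolding e_def by (intro tendsto_intros d r)
  then have "(e \<longlongrightarrow> 0) G" by simp
  \<comment> \<open>After the errors are split off, \<open>x k\<close> is paired only with the fixed
    vector \<open>z - a\<close>, so weak convergence suffices; the limit is the squared norm of
    \<open>z - a\<close>.\<close>
  moreover have "((\<lambda>k. x k \<bullet> (z - a) - a \<bullet> (z - a)) \<longlongrightarrow> z \<bullet> (z - a) - a \<bullet> (z - a)) G"
    by (intro tendsto_intros z)
  moreover have "x k \<bullet> (z - a) - a \<bullet> (z - a) \<le> e k" for k
    using bound[of k] inner_commute[of "z - a" "x k - a"] inner_diff_left[of "x k" a "z - a"] by linarith
  ultimately have "z \<bullet> (z - a) - a \<bullet> (z - a) \<le> 0"
    using G by (intro tendsto_le[of G e 0]) auto
  then have "(z - a) \<bullet> (z - a) \<le> 0" by (simp only: inner_diff_left)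
  then have "z = a" using inner_ge_zero[of "z - a"] by (metis antisym eq_iff_diff_eq_0 inner_eq_zero_iff)
  with a show ?thesis by (simp add: zer_op_sum_iff)
qed

text \<open>In the difference of the two squared distances the quadratic term in \<open>x k\<close>
  cancels. Hence \<open>x k \<bullet> S (l' - l)\<close> converges along the whole sequence, and
  both cluster points give it the same limit.\<close>

lemma weak_cluster_points_eq:
  fixes S :: "'a::{real_inner,complete_space} \<Rightarrow> 'a"
  assumes S: "S \<in> posdef_ops"
    and conv: "convergent (\<lambda>k. (x k - l) \<bullet> S (x k - l))" "convergent (\<lambda>k. (x k - l') \<bullet> S (x k - l'))"
    and G: "G \<noteq> bot" "G \<le> sequentially" "\<And>y. ((\<lambda>k. x k \<bullet> y) \<longlongrightarrow> l \<bullet> y) G"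
    and G': "G' \<noteq> bot" "G' \<le> sequentially" "\<And>y. ((\<lambda>k. x k \<bullet> y) \<longlongrightarrow> l' \<bullet> y) G'"
  shows "l' = l"
proof -
  let ?q = "\<lambda>v. v \<bullet> S v"
  have "x k \<bullet> S (l' - l) = (?q (x k - l) - ?q (x k - l') + (?q l' - ?q l)) / 2" for k
    using posdef_sym[OF S, of "x k" l] posdef_sym[OF S, of "x k" l']
    by (simp add: posdef_diff[OF S] inner_diff inner_commute)
  moreover have "convergent (\<lambda>k. (?q (x k - l) - ?q (x k - l') + (?q l' - ?q l)) / 2)"
    unfolding divide_inverse by (intro convergent_mult convergent_add convergent_diff convergent_const conv)
  ultimately obtain c where c: "(\<lambda>k. x k \<bullet> S (l' - l)) \<longlonglongrightarrow> c"
    unfolding convergent_def by auto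
  have "l \<bullet> S (l' - l) = c"
    using tendsto_unique[OF G(1) G(3) tendsto_mono[OF G(2) c]] .
  moreover have "l' \<bullet> S (l' - l) = c"
    using tendsto_unique[OF G'(1) G'(3) tendsto_mono[OF G'(2) c]] .
  ultimately have "(l' - l) \<bullet> S (l' - l) \<le> 0" by (simp add: inner_diff_left)
  then show "l' = l" using posdef_eq_0[OF S] by fastforce
qed

lemma tendsto_posdef_0_iff:
  assumes S: "S \<in> posdef_ops"
  shows "((\<lambda>k. x k \<bullet> S (x k)) \<longlongrightarrow> 0) F \<longleftrightarrow> (x \<longlongrightarrow> 0) F"
proof -
  obtain l u where l: "0 < l" "\<And>x. l * (norm x)\<^sup>2 \<le> x \<bullet> S x" "\<And>x. x \<bullet> S x \<le> u * (norm x)\<^sup>2"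
    using posdef_bounds[OF S] by blast
  show ?thesis
  proof
    assume "((\<lambda>k. x k \<bullet> S (x k)) \<longlongrightarrow> 0) F"
    then have lim: "((\<lambda>k. x k \<bullet> S (x k) / l) \<longlongrightarrow> 0) F" by (rule tendsto_divide_zero)
    have "((\<lambda>k. (norm (x k))\<^sup>2) \<longlongrightarrow> 0) F"
      by (rule tendsto_sandwich[OF _ _ tendsto_const lim])
         (use l in \<open>auto intro!: always_eventually simp: field_simps\<close>)
    then have "((\<lambda>k. sqrt ((norm (x k))\<^sup>2)) \<longlongrightarrow> sqrt 0) F" by (rule tendsto_real_sqrt)
    then show "(x \<longlongrightarrow> 0) F" by (simp add: tendsto_norm_zero_iff)
  next
    assume "(x \<longlongrightarrow> 0) F"
    then have "((\<lambda>k. u * (norm (x k))\<^sup>2) \<longlongrightarrow> u * (norm (0::'a))\<^sup>2) F" by (intro tendsto_intros)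
    then have lim: "((\<lambda>k. u * (norm (x k))\<^sup>2) \<longlongrightarrow> 0) F" by simp
    show "((\<lambda>k. x k \<bullet> S (x k)) \<longlongrightarrow> 0) F"
      by (rule tendsto_sandwich[OF _ _ tendsto_const lim])
         (use l(3) posdef_nonneg[OF S] in \<open>auto intro!: always_eventually\<close>)
  qed
qed

text \<open>Eventually \<open>t k\<close> exceeds a fixed positive number, so \<open>b k\<close> is
  dominated by a multiple of \<open>a k - a (Suc k)\<close>, which tends to 0.\<close>

lemma decreasing_step_tendsto_0:
  fixes a b t :: "nat \<Rightarrow> real"
  assumes "convergent a" and step: "\<And>k. a (Suc k) \<le> a k - t k * b k" and "\<And>k. 0 \<le> b k"
    and t: "0 < liminf (\<lambda>k. ereal (t k))"
  shows "b \<longlonglongrightarrow> 0"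
proof -
  obtain \<epsilon> where "0 < ereal \<epsilon>" "ereal \<epsilon> < liminf (\<lambda>k. ereal (t k))"
    using ereal_dense2[OF t] by blast
  then have \<epsilon>: "0 < \<epsilon>" "\<forall>\<^sub>F k in sequentially. \<epsilon> < t k"
    using less_LiminfD[of "ereal \<epsilon>" sequentially "\<lambda>k. ereal (t k)"] by auto
  obtain c where c: "a \<longlonglongrightarrow> c" using assms(1) by (auto simp: convergent_def)
  have "(\<lambda>k. (a k - a (Suc k)) / \<epsilon>) \<longlonglongrightarrow> (c - c) / \<epsilon>"
    using \<epsilon>(1) by (intro tendsto_intros c LIMSEQ_Suc) auto
  then have lim: "(\<lambda>k. (a k - a (Suc k)) / \<epsilon>) \<longlonglongrightarrow> 0" by simp
  have "\<forall>\<^sub>F k in sequentially. b k \<le> (a k - a (Suc k)) / \<epsilon>"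
    using \<epsilon>(2)
  proof eventually_elim
    fix k assume "\<epsilon> < t k"
    then have "\<epsilon> * b k \<le> t k * b k" using assms(3)[of k] by (intro mult_right_mono) auto
    then show "b k \<le> (a k - a (Suc k)) / \<epsilon>"
      using step[of k] \<epsilon>(1) by (simp add: pos_le_divide_eq mult.commute)
  qed
  then show ?thesis
    using assms(3) by (intro tendsto_sandwich[OF _ _ tendsto_const lim]) auto
qed

section \<open>Convergence of nonlinear forward-backward splitting\<close>

theorem theorem2:
  fixes P S :: "'a::{real_inner, complete_space} \<Rightarrow> 'a"
    and A :: "'a \<Rightarrow> 'a set"
    and C :: "'a \<Rightarrow> 'a"
    and M :: "nat \<Rightarrow> 'a \<Rightarrow> 'a"
    and \<theta> :: "nat \<Rightarrow> real"
    and \<beta> L\<^sub>M :: real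
    and x0 :: 'a
  assumes "P \<in> posdef_ops" and "S \<in> posdef_ops"
    and "0 \<le> \<beta>" and "\<beta> < 4"
    and "maximal_monotone A"
    and "cocoercive_wrt P \<beta> C"
    and "zer (op_sum A (\<lambda>x. {C x})) \<noteq> {}"
    and "\<And>k. maximal_monotone (\<lambda>x. {M k x})"
    and "\<And>k. strongly_monotone_wrt P 1 (M k)"
    and "\<And>k. L\<^sub>M-lipschitz_on UNIV (M k)"
    and "\<And>k. 0 < \<theta> k \<and> \<theta> k < 2"
    and "liminf (\<lambda>k. ereal (\<theta> k * (2 - \<theta> k))) > 0"
  shows "(\<exists>!s. nofob_iterates P S \<beta> A C M \<theta> x0 (fst s) (snd s)) \<and>
    (\<forall>x xh. nofob_iterates P S \<beta> A C M \<theta> x0 x xh \<longrightarrow>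
       (\<forall>z \<in> zer (op_sum A (\<lambda>x. {C x})). convergent (\<lambda>k. wnorm S (x k - z))) \<and>
       (\<lambda>k. wnorm S (x k - xh k)) \<longlonglongrightarrow> 0 \<and>
       (\<exists>l \<in> zer (op_sum A (\<lambda>x. {C x})). weakly_converges x l))"
proof (intro conjI allI impI)
  note P = assms(1) and S = assms(2) and \<beta> = assms(3) and A = assms(5) and C = assms(6)
    and M = assms(9) and L = assms(10)
  show "\<exists>!s. nofob_iterates P S \<beta> A C M \<theta> x0 (fst s) (snd s)"
    by (intro nofob_iterates_ex1 resolvent_ex1[OF A P M L] nofob_projection_ex1[OF S \<beta>])
  fix x xh assume it: "nofob_iterates P S \<beta> A C M \<theta> x0 x xh"
  let ?Z = "zer (op_sum A (\<lambda>x. {C x}))" and ?q = "\<lambda>v. v \<bullet> S v"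
  let ?H = "\<lambda>k. nofob_halfspace P \<beta> (M k) (x k) (xh k)"
  have xh: "xh k \<in> op_inverse (op_sum (\<lambda>y. {M k y}) A) (M k (x k) - C (x k))" for k
    using it by (simp add: nofob_iterates_def)
  have "\<forall>k. \<exists>p. p \<in> proj_set S (?H k) (x k) \<and> x (Suc k) = (1 - \<theta> k) *\<^sub>R x k + \<theta> k *\<^sub>R p"
    using it unfolding nofob_iterates_def by blast
  then obtain p where p: "\<And>k. p k \<in> proj_set S (?H k) (x k)"
      "\<And>k. x (Suc k) = (1 - \<theta> k) *\<^sub>R x k + \<theta> k *\<^sub>R p k"
    by (metis (no_types))
  have step: "?q (x (Suc k) - z) \<le> ?q (x k - z) - \<theta> k * (2 - \<theta> k) * ?q (p k - x k)"
    if "z \<in> ?Z" for z k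
    using zer_subset_nofob_halfspace[OF A P \<beta> C xh] that assms(11)[of k]
    by (intro relaxed_projection_fejer[OF S convex_nofob_halfspace p(1) _ _ p(2)]) auto
  have mono: "?q (x (Suc k) - z) \<le> ?q (x k - z)" if "z \<in> ?Z" for z k
  proof -
    have "0 \<le> \<theta> k * (2 - \<theta> k) * ?q (p k - x k)"
      using assms(11)[of k] posdef_nonneg[OF S] by (intro mult_nonneg_nonneg) auto
    with step[OF that, of k] show ?thesis by linarith
  qed
  have conv: "convergent (\<lambda>k. ?q (x k - z))" if "z \<in> ?Z" for z
  proof -
    have "decseq (\<lambda>k. ?q (x k - z))" by (rule decseq_SucI) (rule mono[OF that])
    moreover have "\<forall>k. 0 \<le> ?q (x k - z)" using posdef_nonneg[OF S] by blast
    ultimately show ?thesis by (rule decseq_convergent) (rule convergentI)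
  qed
  show "\<forall>z\<in>?Z. convergent (\<lambda>k. wnorm S (x k - z))"
  proof
    fix z assume "z \<in> ?Z"
    then obtain c where "(\<lambda>k. ?q (x k - z)) \<longlonglongrightarrow> c" using conv convergent_def by metis
    then show "convergent (\<lambda>k. wnorm S (x k - z))"
      unfolding wnorm_def by (intro convergentI[of _ "sqrt c"] tendsto_real_sqrt)
  qed

  \<comment> \<open>One solution suffices to make the projection steps vanish and to bound the
    iterates.\<close>
  obtain z where z: "z \<in> ?Z" using assms(7) by blast
  have "(\<lambda>k. ?q (p k - x k)) \<longlonglongrightarrow> 0"
    using decreasing_step_tendsto_0[OF conv[OF z] step[OF z] _ assms(12)] posdef_nonneg[OF S] by blast
  then have px: "(\<lambda>k. p k - x k) \<longlonglongrightarrow> 0" by (simp add: tendsto_posdef_0_iff[OF S])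
  obtain l where l: "0 < l" "\<And>v. l * (norm v)\<^sup>2 \<le> v \<bullet> P v" using posdef_bounds[OF P] by blast
  define c where "c = (1 - \<beta> / 4) * l"
  have c: "0 < c" using l(1) assms(4) by (simp add: c_def)
  have "norm (x k - xh k) \<le> L\<^sub>M / c * norm (p k - x k)" for k
  proof -
    have "p k \<in> ?H k" using p(1)[of k] by (simp add: proj_set_convex_iff[OF S convex_nofob_halfspace])
    have "c * (norm (x k - xh k))\<^sup>2 \<le> (1 - \<beta> / 4) * ((x k - xh k) \<bullet> P (x k - xh k))"
      unfolding c_def mult.assoc using l(2) assms(4) by (intro mult_left_mono) auto
    also have "\<dots> \<le> L\<^sub>M * norm (x k - xh k) * norm (x k - p k)"
      by (rule nofob_halfspace_distance[OF P M L \<open>p k \<in> ?H k\<close>])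
    finally have "norm (x k - xh k) * (c * norm (x k - xh k)) \<le> norm (x k - xh k) * (L\<^sub>M * norm (p k - x k))"
      by (simp add: power2_eq_square norm_minus_commute mult_ac)
    moreover have "0 \<le> L\<^sub>M" using L lipschitz_on_nonneg by blast
    \<comment> \<open>The common factor is cancelled; when it is zero, the claim reduces to
      \<open>0 \<le> L\<^sub>M * norm (p k - x k)\<close>.\<close>
    ultimately have "c * norm (x k - xh k) \<le> L\<^sub>M * norm (p k - x k)"
      by (cases "x k = xh k") (simp_all add: mult_le_cancel_left)
    then show ?thesis using c by (simp add: field_simps)
  qed
  moreover have "(\<lambda>k. L\<^sub>M / c * norm (p k - x k)) \<longlonglongrightarrow> 0"
    using tendsto_mult_left[OF tendsto_norm[OF px], of "L\<^sub>M / c"] by simp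
  ultimately have d: "(\<lambda>k. x k - xh k) \<longlonglongrightarrow> 0"
    by (rule Lim_null_comparison[OF always_eventually[OF allI]])
  then have "(\<lambda>k. ?q (x k - xh k)) \<longlonglongrightarrow> 0" by (simp add: tendsto_posdef_0_iff[OF S])
  then have "(\<lambda>k. sqrt (?q (x k - xh k))) \<longlonglongrightarrow> sqrt 0" by (rule tendsto_real_sqrt)
  then show "(\<lambda>k. wnorm S (x k - xh k)) \<longlonglongrightarrow> 0" by (simp add: wnorm_def)

  obtain m where m: "0 < m" "\<And>v. m * (norm v)\<^sup>2 \<le> ?q v" using posdef_bounds[OF S] by blast
  define B where "B = sqrt (?q (x 0 - z) / m) + norm z"
  have B: "norm (x k) \<le> B" for k
  proof -
    have "?q (x k - z) \<le> ?q (x 0 - z)" by (induction k) (auto intro: order_trans[OF mono[OF z]])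
    then have "(norm (x k - z))\<^sup>2 \<le> ?q (x 0 - z) / m"
      using m(1) m(2)[of "x k - z"] by (simp add: pos_le_divide_eq mult.commute)
    then have "norm (x k - z) \<le> sqrt (?q (x 0 - z) / m)" by (rule real_le_rsqrt)
    then show ?thesis using norm_triangle_sub[of "x k" z] by (simp add: B_def)
  qed
  obtain K where K: "0 \<le> K" "\<And>x y. norm (C x - C y) \<le> K * norm (x - y)"
    using cocoercive_lipschitz[OF P \<beta> C] by blast
  \<comment> \<open>This is the element of \<open>A (xh k)\<close> given by the resolvent inclusion.
    Adding \<open>C (x k)\<close> leaves \<open>M k (x k) - M k (xh k)\<close>, which tends to 0
    because the Lipschitz constant is the same for all \<open>k\<close>.\<close>
  define u where "u k = M k (x k) - C (x k) - M k (xh k)" for k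
  have u: "u k \<in> A (xh k)" for k using xh[of k] by (simp add: op_inverse_op_sum_iff u_def)
  have "norm (u k + C (x k)) \<le> norm (x k - xh k) * L\<^sub>M" for k
    using lipschitz_onD[OF L[of k] UNIV_I UNIV_I, of "x k" "xh k"] by (simp add: u_def dist_norm mult.commute)
  then have r: "(\<lambda>k. u k + C (x k)) \<longlonglongrightarrow> 0"
    by (intro tendsto_0_le[OF d always_eventually[OF allI]])
  have d': "(\<lambda>k. xh k - x k) \<longlonglongrightarrow> 0" using tendsto_minus[OF d] by simp
  have cluster: "l \<in> ?Z"
    if "G \<noteq> bot" "G \<le> sequentially" "\<And>v. ((\<lambda>k. x k \<bullet> v) \<longlongrightarrow> l \<bullet> v) G" for l G
    using weak_cluster_point_in_zer[OF A cocoercive_monotone[OF \<beta> C] K(2,1) u B that(1,3)]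
      tendsto_mono[OF that(2) d'] tendsto_mono[OF that(2) r] by simp
  obtain l G where G: "G \<noteq> bot" "G \<le> sequentially" "\<And>v. ((\<lambda>k. x k \<bullet> v) \<longlongrightarrow> l \<bullet> v) G"
    using weak_cluster_point[of sequentially x B] B by auto
  \<comment> \<open>Cluster points are solutions, so the squared \<open>S\<close>-distances to any
    two of them converge, and Opial's argument identifies them.\<close>
  have "weakly_converges x l"
    using B
  proof (rule weakly_converges_unique_cluster)
    fix G' l' assume G': "G' \<noteq> bot" "G' \<le> sequentially" "\<And>v. ((\<lambda>k. x k \<bullet> v) \<longlongrightarrow> l' \<bullet> v) G'"
    show "l' = l"
      by (rule weak_cluster_points_eq[OF S conv conv G G'])
         (intro cluster[OF G] cluster[OF G'])+
  qed
  with cluster[OF G] show "\<exists>l\<in>?Z. weakly_converges x l" by blast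
qed

end
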